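(* Let $R$ be a ring. Then $R$ is Armendariz of the Hurwitz series type if and only if the Hurwitz polynomial ring $hR$ is Armendariz of the Hurwitz series type.
   Context: All rings are associative with identity and not necessarily commutative; $\mathbb{N}=\{0,1,2,\ldots\}$. For a ring $R$, the Hurwitz series ring $HR$ is the set of all sequences $a=(a_n)=(a_0,a_1,a_2,\ldots)$ with $a_n\in R$ for every $n\in\mathbb{N}$, with termwise addition and with product $(a_n)(b_n)=(c_n)$, where $c_n=\sum_{k=0}^n \binom{n}{k}a_k b_{n-k}$. Its identity is $(1,0,0,\ldots)$. The Hurwitz polynomial ring $hR$ is the subring of $HR$ consisting of the sequences with only finitely many nonzero terms. A ring $R$ is called Armendariz of the Hurwitz series type if for all $f=(a_0,a_1,a_2,\ldots)$ and $g=(b_0,b_1,b_2,\ldots)$ in $HR$, $fg=0$ if and only if $a_ib_j=0$ for all $i,j$. The definition applies to $hR$ in place of $R$ by using the ring $H(hR)$. *)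

theory Defs
  imports "HOL-Algebra.Ring"
begin

text \<open>
  A sequence over a ring \<open>R\<close> is a function \<open>nat \<Rightarrow> 'a\<close> with all values in \<open>carrier R\<close>;
  the natural number multiple \<open>[n] \<cdot>\<^bsub>R\<^esub> x\<close> is the \<open>n\<close>-fold sum of \<open>x\<close> in \<open>R\<close>.
\<close>

definition hurwitz_series_ring :: "('a, 'm) ring_scheme \<Rightarrow> (nat \<Rightarrow> 'a) ring" where
  "hurwitz_series_ring R =
     \<lparr>carrier = {a. \<forall>n. a n \<in> carrier R},
      mult = (\<lambda>a b n. \<Oplus>\<^bsub>R\<^esub>k\<in>{..n}. [(n choose k)] \<cdot>\<^bsub>R\<^esub> (a k \<otimes>\<^bsub>R\<^esub> b (n - k))),
      one = (\<lambda>n. if n = 0 then \<one>\<^bsub>R\<^esub> else \<zero>\<^bsub>R\<^esub>),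
      zero = (\<lambda>n. \<zero>\<^bsub>R\<^esub>),
      add = (\<lambda>a b n. a n \<oplus>\<^bsub>R\<^esub> b n)\<rparr>"

definition hurwitz_poly_ring :: "('a, 'm) ring_scheme \<Rightarrow> (nat \<Rightarrow> 'a) ring" where
  "hurwitz_poly_ring R =
     (hurwitz_series_ring R)
       \<lparr>carrier := {a \<in> carrier (hurwitz_series_ring R). finite {n. a n \<noteq> \<zero>\<^bsub>R\<^esub>}}\<rparr>"

definition armendariz_hurwitz_series :: "('a, 'm) ring_scheme \<Rightarrow> bool" where
  "armendariz_hurwitz_series R \<longleftrightarrow>
     (\<forall>f \<in> carrier (hurwitz_series_ring R). \<forall>g \<in> carrier (hurwitz_series_ring R).
        f \<otimes>\<^bsub>hurwitz_series_ring R\<^esub> g = \<zero>\<^bsub>hurwitz_series_ring R\<^esub> \<longleftrightarrow>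
        (\<forall>i j. f i \<otimes>\<^bsub>R\<^esub> g j = \<zero>\<^bsub>R\<^esub>))"

end

theory Submission
  imports Defs "HOL-Algebra.UnivPoly"
begin

text \<open>
  For the nontrivial direction, let \<open>R\<close> be Armendariz of the Hurwitz series type. Then \<open>R\<close> has no
  additive torsion, since \<open>n r = 0\<close> says that \<open>x\<close> times \<open>r x^(n-1) / (n-1)!\<close> vanishes. An element of
  \<open>H(hR)\<close> is a double series in divided powers of \<open>x\<close> and \<open>y\<close>. If \<open>F G = 0\<close>, substituting \<open>y = t x\<close>
  for natural numbers \<open>t\<close> gives a zero product in \<open>HR\<close>, whose factors have coefficients polynomial in
  \<open>t\<close>. Hence the products of these coefficients vanish for all \<open>t\<close>, so they vanish as polynomials
  because \<open>R\<close> is torsion-free, and the Armendariz property applied to these polynomials separates the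
  individual entries of \<open>F\<close> and \<open>G\<close>. The converse embeds \<open>R\<close> into \<open>hR\<close> as constants.
\<close>

section \<open>Finite sums in abelian monoids and semirings\<close>

context abelian_monoid
begin

lemma add_pow_finsum:
  fixes n :: nat
  assumes "\<And>x. x \<in> A \<Longrightarrow> f x \<in> carrier G"
  shows "[n] \<cdot> (\<Oplus>x\<in>A. f x) = (\<Oplus>x\<in>A. [n] \<cdot> f x)"
  using assms
  by (induction A rule: infinite_finite_induct) (auto simp: Pi_def add.nat_pow_distrib)

text \<open>Turns an iterated sum into one sum over index pairs, so that changing the order of
  summation becomes reindexing along a bijection.\<close>

lemma finsum_Sigma:
  assumes "finite A" "\<And>x. x \<in> A \<Longrightarrow> finite (B x)"
    and "\<And>x y. x \<in> A \<Longrightarrow> y \<in> B x \<Longrightarrow> f (x, y) \<in> carrier G"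
  shows "(\<Oplus>x\<in>A. \<Oplus>y\<in>B x. f (x, y)) = finsum G f (Sigma A B)"
  using assms
proof (induction A rule: finite_induct)
  case empty
  then show ?case by simp
next
  case (insert a A)
  have "finsum G f (Sigma (insert a A) B) = finsum G f (Pair a ` B a \<union> Sigma A B)"
    by (rule arg_cong[where f = "finsum G f"]) auto
  also have "\<dots> = finsum G f (Pair a ` B a) \<oplus> finsum G f (Sigma A B)"
    using insert by (intro finsum_Un_disjoint) auto
  also have "finsum G f (Pair a ` B a) = (\<Oplus>y\<in>B a. f (a, y))"
    using insert.prems by (subst finsum_reindex) (auto simp: inj_on_def)
  also have "finsum G f (Sigma A B) = (\<Oplus>x\<in>A. \<Oplus>y\<in>B x. f (x, y))"
    using insert by simp
  also have "(\<Oplus>y\<in>B a. f (a, y)) \<oplus> \<dots> = (\<Oplus>x\<in>insert a A. \<Oplus>y\<in>B x. f (x, y))"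
    using insert by (subst finsum_insert) (auto intro!: finsum_closed)
  finally show ?case ..
qed

end

lemma (in semiring) finsum_mult_finsum:
  assumes "finite A" "finite B" "\<And>i. i \<in> A \<Longrightarrow> f i \<in> carrier R" "\<And>j. j \<in> B \<Longrightarrow> g j \<in> carrier R"
  shows "(\<Oplus>i\<in>A. f i) \<otimes> (\<Oplus>j\<in>B. g j) = (\<Oplus>i\<in>A. \<Oplus>j\<in>B. f i \<otimes> g j)"
proof -
  have "(\<Oplus>i\<in>A. f i) \<otimes> (\<Oplus>j\<in>B. g j) = (\<Oplus>i\<in>A. f i \<otimes> (\<Oplus>j\<in>B. g j))"
    using assms by (intro finsum_ldistr) (auto intro!: finsum_closed)
  also have "\<dots> = (\<Oplus>i\<in>A. \<Oplus>j\<in>B. f i \<otimes> g j)"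
    using assms by (intro finsum_cong' finsum_rdistr) (auto intro!: finsum_closed)
  finally show ?thesis .
qed

section \<open>Elementwise forms of the Armendariz condition\<close>

lemma armendariz_hurwitz_seriesD:
  assumes "armendariz_hurwitz_series R" "\<And>i. f i \<in> carrier R" "\<And>i. g i \<in> carrier R"
    and "\<And>n. (\<Oplus>\<^bsub>R\<^esub>k\<in>{..n}. [(n choose k)] \<cdot>\<^bsub>R\<^esub> (f k \<otimes>\<^bsub>R\<^esub> g (n - k))) = \<zero>\<^bsub>R\<^esub>"
  shows "f i \<otimes>\<^bsub>R\<^esub> g j = \<zero>\<^bsub>R\<^esub>"
proof -
  let ?H = "hurwitz_series_ring R"
  have "f \<in> carrier ?H" "g \<in> carrier ?H" "f \<otimes>\<^bsub>?H\<^esub> g = \<zero>\<^bsub>?H\<^esub>"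
    using assms(2-4) by (auto simp: hurwitz_series_ring_def)
  with assms(1) show ?thesis unfolding armendariz_hurwitz_series_def by blast
qed

text \<open>The other half of the equivalence is automatic: if all \<open>f i \<otimes> g j\<close>
  vanish, every convolution is a sum of multiples of zero. Assuming only an abelian monoid lets the
  rule apply to \<open>hR\<close> through its additive structure.\<close>

lemma armendariz_hurwitz_seriesI:
  assumes "abelian_monoid R"
    and "\<And>f g i j. (\<And>i. f i \<in> carrier R) \<Longrightarrow> (\<And>i. g i \<in> carrier R) \<Longrightarrow>
      (\<And>n. (\<Oplus>\<^bsub>R\<^esub>k\<in>{..n}. [(n choose k)] \<cdot>\<^bsub>R\<^esub> (f k \<otimes>\<^bsub>R\<^esub> g (n - k))) = \<zero>\<^bsub>R\<^esub>) \<Longrightarrow>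
      f i \<otimes>\<^bsub>R\<^esub> g j = \<zero>\<^bsub>R\<^esub>"
  shows "armendariz_hurwitz_series R"
proof -
  interpret abelian_monoid R by fact
  show ?thesis
    using assms(2)
    by (auto simp: armendariz_hurwitz_series_def hurwitz_series_ring_def fun_eq_iff)
qed

section \<open>Additive torsion and vanishing of polynomial values\<close>

definition torsion_free :: "('a, 'm) ring_scheme \<Rightarrow> bool" where
  "torsion_free R \<longleftrightarrow>
     (\<forall>n::nat. \<forall>r\<in>carrier R. 0 < n \<longrightarrow> [n] \<cdot>\<^bsub>R\<^esub> r = \<zero>\<^bsub>R\<^esub> \<longrightarrow> r = \<zero>\<^bsub>R\<^esub>)"

lemma torsion_freeD:
  fixes n :: nat
  assumes "torsion_free R" "[n] \<cdot>\<^bsub>R\<^esub> r = \<zero>\<^bsub>R\<^esub>" "0 < n" "r \<in> carrier R"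
  shows "r = \<zero>\<^bsub>R\<^esub>"
  using assms by (auto simp: torsion_free_def)

context ring
begin

lemma armendariz_imp_torsion_free:
  assumes "armendariz_hurwitz_series R"
  shows "torsion_free R"
  unfolding torsion_free_def
proof (intro allI ballI impI)
  fix n :: nat and r
  assume r: "r \<in> carrier R" and "0 < n" and nr: "[n] \<cdot> r = \<zero>"
  define f where "f i = (if i = 1 then \<one> else \<zero>)" for i :: nat
  define g where "g i = (if Suc i = n then r else \<zero>)" for i
  have "f 1 \<otimes> g (n - 1) = \<zero>"
  proof (rule armendariz_hurwitz_seriesD[OF assms])
    fix m
    show "(\<Oplus>k\<in>{..m}. [(m choose k)] \<cdot> (f k \<otimes> g (m - k))) = \<zero>"
    proof (rule add.finprod_one_eqI)
      fix k assume "k \<in> {..m}"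
      \<comment> \<open>A nonzero term forces \<open>k = 1\<close> and \<open>m = n\<close>; its
        binomial factor is then \<open>n\<close>, and \<open>nr\<close> kills it.\<close>
      moreover have "m = n" if "k = 1" "Suc (m - k) = n" "k \<le> m"
        using that by simp
      ultimately show "[(m choose k)] \<cdot> (f k \<otimes> g (m - k)) = \<zero>"
        using r nr by (auto simp: f_def g_def)
    qed
  qed (auto simp: f_def g_def r)
  then show "r = \<zero>" using r \<open>0 < n\<close> by (simp add: f_def g_def)
qed

text \<open>The leading term cancels in \<open>2\<^sup>d p(t) - p(2t)\<close>, which lowers the degree.\<close>

lemma torsion_free_coeffs_zero:
  assumes tf: "torsion_free R" and c: "\<And>k. c k \<in> carrier R"
    and "\<And>t::nat. 0 < t \<Longrightarrow> (\<Oplus>k\<in>{..d}. [(t ^ k)] \<cdot> c k) = \<zero>"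
    and "k \<le> d"
  shows "c k = \<zero>"
  using c assms(3,4)
proof (induction d arbitrary: c k)
  case 0
  from "0.prems"(2)[of 1] "0.prems"(1,3) show ?case by simp
next
  case (Suc d)
  note c = \<open>\<And>k. c k \<in> carrier R\<close>
  \<comment> \<open>\<open>a k\<close> is the factor of the \<open>k\<close>-th coefficient in
    \<open>2^(d+1) p(t) - p(2t)\<close>: it is zero at \<open>k = Suc d\<close> and positive
    below.\<close>
  define a where "a k = (2 ^ Suc d - 2 ^ k :: nat)" for k
  have low: "c k = \<zero>" if k: "k \<le> d" for k
  proof -
    have "[a k] \<cdot> c k = \<zero>"
    proof (rule Suc.IH[where c = "\<lambda>k. [a k] \<cdot> c k", OF _ _ k])
      fix t :: nat assume t: "0 < t"
      \<comment> \<open>The cancellation is written additively, which keeps all multiples natural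
        numbers.\<close>
      have split: "[((2::nat) ^ Suc d)] \<cdot> ([(t ^ k)] \<cdot> c k) = [(t ^ k)] \<cdot> ([a k] \<cdot> c k) \<oplus> [((2 * t) ^ k)] \<cdot> c k"
        if "k \<le> Suc d" for k
      proof -
        have "(2::nat) ^ k \<le> 2 ^ Suc d" using that by (intro power_increasing) auto
        then have "t ^ k * 2 ^ Suc d = a k * t ^ k + (2 * t) ^ k"
          by (simp add: a_def power_mult_distrib algebra_simps flip: distrib_left)
        then show ?thesis using c by (simp add: add.nat_pow_pow add.nat_pow_mult del: power_Suc)
      qed
      have "\<zero> = [((2::nat) ^ Suc d)] \<cdot> (\<Oplus>k\<in>{..Suc d}. [(t ^ k)] \<cdot> c k)"
        using Suc.prems(2)[OF t] by simp
      also have "\<dots> = (\<Oplus>k\<in>{..Suc d}. [((2::nat) ^ Suc d)] \<cdot> ([(t ^ k)] \<cdot> c k))"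
        using c by (intro add_pow_finsum) auto
      also have "\<dots> = (\<Oplus>k\<in>{..Suc d}. [(t ^ k)] \<cdot> ([a k] \<cdot> c k) \<oplus> [((2 * t) ^ k)] \<cdot> c k)"
        using c by (intro finsum_cong') (auto simp: split simp del: power_Suc)
      also have "\<dots> = (\<Oplus>k\<in>{..Suc d}. [(t ^ k)] \<cdot> ([a k] \<cdot> c k))
          \<oplus> (\<Oplus>k\<in>{..Suc d}. [((2 * t) ^ k)] \<cdot> c k)"
        using c by (intro finsum_addf) auto
      also have "(\<Oplus>k\<in>{..Suc d}. [((2 * t) ^ k)] \<cdot> c k) = \<zero>"
        using Suc.prems(2)[of "2 * t"] t by simp
      finally show "(\<Oplus>k\<in>{..d}. [(t ^ k)] \<cdot> ([a k] \<cdot> c k)) = \<zero>"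
        using c by (simp add: a_def Pi_def)
    qed (use c in auto)
    moreover have "0 < a k"
      using k power_strict_increasing[of k "Suc d" "2::nat"] by (simp add: a_def)
    ultimately show ?thesis using torsion_freeD[OF tf] c by blast
  qed
  \<comment> \<open>Once the lower coefficients vanish, the value at \<open>t = 1\<close> is the
    leading coefficient.\<close>
  have "(\<Oplus>k\<in>{..Suc d}. c k) = \<zero>" using Suc.prems(2)[of 1] c by simp
  moreover have "(\<Oplus>k\<in>{..d}. c k) = \<zero>" by (rule add.finprod_one_eqI) (simp add: low)
  ultimately have "c (Suc d) = \<zero>" using c by (simp add: Pi_def)
  then show ?case using low Suc.prems(3) by (cases "k = Suc d") auto
qed

section \<open>The Armendariz property for Cauchy products\<close>

text \<open>The map \<open>a\<^sub>i \<mapsto> i! a\<^sub>i\<close> turns the Cauchy product into the Hurwitz product.\<close>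

lemma armendariz_cauchy:
  fixes p q :: "nat \<Rightarrow> 'a"
  assumes A: "armendariz_hurwitz_series R"
    and p: "\<And>i. p i \<in> carrier R" and q: "\<And>i. q i \<in> carrier R"
    and pq: "\<And>s. (\<Oplus>i\<in>{..s}. p i \<otimes> q (s - i)) = \<zero>"
  shows "p i \<otimes> q j = \<zero>"
proof -
  have "([(fact i :: nat)] \<cdot> p i) \<otimes> ([(fact j :: nat)] \<cdot> q j) = \<zero>"
  proof (rule armendariz_hurwitz_seriesD[OF A, where f = "\<lambda>i. [(fact i :: nat)] \<cdot> p i"
        and g = "\<lambda>j. [(fact j :: nat)] \<cdot> q j"])
    fix n :: nat
    have "(\<Oplus>k\<in>{..n}. [(n choose k)] \<cdot> (([(fact k :: nat)] \<cdot> p k) \<otimes> ([(fact (n - k) :: nat)] \<cdot> q (n - k))))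
       = (\<Oplus>k\<in>{..n}. [(fact n :: nat)] \<cdot> (p k \<otimes> q (n - k)))"
      using p q binomial_fact_lemma[of _ n]
      by (intro finsum_cong') (auto simp: add_pow_ldistr add_pow_rdistr add.nat_pow_pow mult_ac)
    also have "\<dots> = [(fact n :: nat)] \<cdot> (\<Oplus>k\<in>{..n}. p k \<otimes> q (n - k))"
      using p q by (intro add_pow_finsum[symmetric]) auto
    finally show "(\<Oplus>k\<in>{..n}. [(n choose k)] \<cdot> (([(fact k :: nat)] \<cdot> p k) \<otimes> ([(fact (n - k) :: nat)] \<cdot> q (n - k)))) = \<zero>"
      by (simp add: pq)
  qed (use p q in auto)
  \<comment> \<open>The factorials introduced by the rescaling are cancelled by
    torsion-freeness.\<close>
  then have "[(fact j * fact i :: nat)] \<cdot> (p i \<otimes> q j) = \<zero>"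
    using p q by (simp add: add_pow_ldistr add_pow_rdistr add.nat_pow_pow mult_ac)
  then show ?thesis
    by (rule torsion_freeD[OF armendariz_imp_torsion_free[OF A]]) (use p q in auto)
qed

text \<open>Multiples by powers of \<open>t\<close> commute with multiplication, so the product of
  the values is the value of the Cauchy product. Torsion-freeness makes its coefficients vanish, and
  \<open>armendariz_cauchy\<close> separates the factors.\<close>

lemma armendariz_evaluation:
  fixes p q :: "nat \<Rightarrow> 'a"
  assumes A: "armendariz_hurwitz_series R"
    and p: "\<And>i. p i \<in> carrier R" "\<And>i. m < i \<Longrightarrow> p i = \<zero>"
    and q: "\<And>i. q i \<in> carrier R" "\<And>i. n < i \<Longrightarrow> q i = \<zero>"
    and pq: "\<And>t::nat. (\<Oplus>i\<in>{..m}. [(t ^ i)] \<cdot> p i) \<otimes> (\<Oplus>i\<in>{..n}. [(t ^ i)] \<cdot> q i) = \<zero>"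
  shows "p i \<otimes> q j = \<zero>"
proof (rule armendariz_cauchy[OF A])
  fix s
  show "(\<Oplus>i\<in>{..s}. p i \<otimes> q (s - i)) = \<zero>"
  proof (cases "s \<le> m + n")
    case True
    show ?thesis
    proof (rule torsion_free_coeffs_zero[OF armendariz_imp_torsion_free[OF A] _ _ True])
      fix t :: nat
      have "(\<Oplus>s\<in>{..m + n}. [(t ^ s)] \<cdot> (\<Oplus>i\<in>{..s}. p i \<otimes> q (s - i)))
          = (\<Oplus>s\<in>{..m + n}. \<Oplus>i\<in>{..s}. ([(t ^ i)] \<cdot> p i) \<otimes> ([(t ^ (s - i))] \<cdot> q (s - i)))"
      proof (intro finsum_cong')
        fix s
        have "[(t ^ s)] \<cdot> (\<Oplus>i\<in>{..s}. p i \<otimes> q (s - i)) = (\<Oplus>i\<in>{..s}. [(t ^ s)] \<cdot> (p i \<otimes> q (s - i)))"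
          using p q by (intro add_pow_finsum) auto
        also have "\<dots> = (\<Oplus>i\<in>{..s}. ([(t ^ i)] \<cdot> p i) \<otimes> ([(t ^ (s - i))] \<cdot> q (s - i)))"
          using p q by (intro finsum_cong')
            (auto simp: add_pow_ldistr add_pow_rdistr add.nat_pow_pow simp flip: power_add)
        finally show "[(t ^ s)] \<cdot> (\<Oplus>i\<in>{..s}. p i \<otimes> q (s - i)) = \<dots>" .
      qed (use p q in auto)
      also have "\<dots> = (\<Oplus>i\<in>{..m}. [(t ^ i)] \<cdot> p i) \<otimes> (\<Oplus>i\<in>{..n}. [(t ^ i)] \<cdot> q i)"
        using p q by (intro cauchy_product) (auto intro!: bound.intro)
      finally show "(\<Oplus>s\<in>{..m + n}. [(t ^ s)] \<cdot> (\<Oplus>i\<in>{..s}. p i \<otimes> q (s - i))) = \<zero>"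
        by (simp add: pq)
    qed (use p q in auto)
  next
    case False
    \<comment> \<open>Above degree \<open>m + n\<close>, one index of each pair exceeds its
      bound.\<close>
    have "p i = \<zero> \<or> q (s - i) = \<zero>" for i
      using False p(2)[of i] q(2)[of "s - i"] by linarith
    then have "p i \<otimes> q (s - i) = \<zero>" for i
      using p(1)[of i] q(1)[of "s - i"] by (metis l_null r_null)
    then show ?thesis by simp
  qed
qed (use p q in auto)

section \<open>Double series and the substitution y = t x\<close>

text \<open>Both sides are the multinomial coefficient of \<open>k\<close>, \<open>j\<close>,
  \<open>l\<close>, \<open>q\<close>, grouped by factor of the product on the left and by variable
  on the right. Multiplying by the four factorials avoids division.\<close>

lemma choose_mult_rearrange:
  fixes k j l q :: nat
  shows "(k + j + l + q choose (k + j)) * (k + j choose j) * (l + q choose l)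
       = (k + j + l + q choose (j + l)) * (k + q choose k) * (j + l choose j)"
    (is "?L = ?R")
proof -
  have b: "fact a * fact b * (a + b choose a) = fact (a + b)" for a b :: nat
    using binomial_fact_lemma[of a "a + b"] by simp
  let ?d = "fact k * fact j * fact l * fact q :: nat"
  have "?L * ?d = (k + j + l + q choose (k + j)) * (fact j * fact k * (j + k choose j))
      * (fact l * fact q * (l + q choose l))"
    by (simp add: mult_ac add_ac)
  also have "\<dots> = (k + j + l + q choose (k + j)) * fact (j + k) * fact (l + q)"
    by (simp only: b)
  also have "\<dots> = fact (j + l + k + q)"
    using b[of "k + j" "l + q"] by (simp add: mult_ac add_ac)
  also have "\<dots> = (k + j + l + q choose (j + l)) * fact (k + q) * fact (j + l)"
    using b[of "j + l" "k + q"] by (simp add: mult_ac add_ac)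
  also have "\<dots> = (k + j + l + q choose (j + l)) * (fact k * fact q * (k + q choose k))
      * (fact j * fact l * (j + l choose j))"
    by (simp only: b)
  also have "\<dots> = ?R * ?d" by (simp add: mult_ac)
  finally show ?thesis by simp
qed

text \<open>
  A double series stands for the sum of \<open>F n m\<close> times the product of the divided powers
  \<open>x^n / n!\<close> and \<open>y^m / m!\<close>. Substituting \<open>y = t x\<close> sends this product to \<open>t^m * (n + m choose m)\<close>
  times \<open>x^(n+m) / (n+m)!\<close>; the lemma says that the substitution is multiplicative.
\<close>

lemma hurwitz_substitution:
  fixes F G :: "nat \<Rightarrow> nat \<Rightarrow> 'a" and t N :: nat
  assumes F: "\<And>n m. F n m \<in> carrier R" and G: "\<And>n m. G n m \<in> carrier R"
  shows "(\<Oplus>K\<in>{..N}. [(N choose K)] \<cdot>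
            ((\<Oplus>j\<in>{..K}. [(t ^ j)] \<cdot> ([(K choose j)] \<cdot> F (K - j) j)) \<otimes>
             (\<Oplus>l\<in>{..N - K}. [(t ^ l)] \<cdot> ([(N - K choose l)] \<cdot> G (N - K - l) l))))
       = (\<Oplus>s\<in>{..N}. [(t ^ s * (N choose s))] \<cdot> (\<Oplus>k\<in>{..N - s}. [(N - s choose k)] \<cdot>
            (\<Oplus>j\<in>{..s}. [(s choose j)] \<cdot> (F k j \<otimes> G (N - s - k) (s - j)))))"
    (is "?lhs = ?rhs")
proof -
  \<comment> \<open>In \<open>A\<close>, \<open>K\<close> is the total degree taken from
    \<open>F\<close>, and \<open>j\<close>, \<open>l\<close> are the y-degrees from \<open>F\<close>
    and \<open>G\<close>. In \<open>B\<close>, \<open>s\<close> is the total y-degree, and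
    \<open>k\<close>, \<open>j\<close> are the x- and y-degrees from \<open>F\<close>. The map
    \<open>h\<close> translates \<open>B\<close> to \<open>A\<close>.\<close>
  define A where "A = (SIGMA K:{..N}. {..K} \<times> {..N - K})"
  define B where "B = (SIGMA s:{..N}. {..N - s} \<times> {..s})"
  define u where "u = (\<lambda>(K, j, l). [((K choose j) * (N - K choose l) * (N choose K) * t ^ (j + l))] \<cdot>
      (F (K - j) j \<otimes> G (N - K - l) l))"
  define v where "v = (\<lambda>(s, k, j). [((s choose j) * (N - s choose k) * (N choose s) * t ^ s)] \<cdot>
      (F k j \<otimes> G (N - s - k) (s - j)))"
  define h where "h = (\<lambda>(s, k, j). (k + j :: nat, j, s - j :: nat))"
  have "?lhs = (\<Oplus>K\<in>{..N}. \<Oplus>j\<in>{..K}. \<Oplus>l\<in>{..N - K}. u (K, j, l))"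
  proof (rule finsum_cong'[OF refl])
    fix K assume "K \<in> {..N}"
    have "[(N choose K)] \<cdot>
        ((\<Oplus>j\<in>{..K}. [(t ^ j)] \<cdot> ([(K choose j)] \<cdot> F (K - j) j)) \<otimes>
         (\<Oplus>l\<in>{..N - K}. [(t ^ l)] \<cdot> ([(N - K choose l)] \<cdot> G (N - K - l) l)))
      = (\<Oplus>j\<in>{..K}. \<Oplus>l\<in>{..N - K}. [(N choose K)] \<cdot> (([(t ^ j)] \<cdot> ([(K choose j)] \<cdot> F (K - j) j)) \<otimes>
         ([(t ^ l)] \<cdot> ([(N - K choose l)] \<cdot> G (N - K - l) l))))"
      using F G by (simp add: finsum_mult_finsum add_pow_finsum)
    also have "\<dots> = (\<Oplus>j\<in>{..K}. \<Oplus>l\<in>{..N - K}. u (K, j, l))"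
      using F G by (simp add: u_def add_pow_ldistr add_pow_rdistr add.nat_pow_pow power_add mult_ac)
    finally show "[(N choose K)] \<cdot>
        ((\<Oplus>j\<in>{..K}. [(t ^ j)] \<cdot> ([(K choose j)] \<cdot> F (K - j) j)) \<otimes>
         (\<Oplus>l\<in>{..N - K}. [(t ^ l)] \<cdot> ([(N - K choose l)] \<cdot> G (N - K - l) l))) = \<dots>" .
  qed (use F G in \<open>auto simp: u_def\<close>)
  also have "\<dots> = (\<Oplus>K\<in>{..N}. \<Oplus>z\<in>{..K} \<times> {..N - K}. u (K, z))"
    using F G finsum_Sigma[of "{..K}" "\<lambda>_. {..N - K}" "\<lambda>z. u (K, z)" for K]
    by (intro finsum_cong') (auto simp: u_def intro!: finsum_closed)
  also have "\<dots> = finsum R u A"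
    unfolding A_def using F G by (intro finsum_Sigma) (auto simp: u_def)
  finally have L: "?lhs = finsum R u A" .
  have "?rhs = (\<Oplus>s\<in>{..N}. \<Oplus>k\<in>{..N - s}. \<Oplus>j\<in>{..s}. v (s, k, j))"
    using F G by (intro finsum_cong')
      (auto simp: v_def add_pow_finsum add.nat_pow_pow mult_ac intro!: finsum_cong')
  also have "\<dots> = (\<Oplus>s\<in>{..N}. \<Oplus>z\<in>{..N - s} \<times> {..s}. v (s, z))"
    using F G finsum_Sigma[of "{..N - s}" "\<lambda>_. {..s}" "\<lambda>z. v (s, z)" for s]
    by (intro finsum_cong') (auto simp: v_def intro!: finsum_closed)
  also have "\<dots> = finsum R v B"
    unfolding B_def using F G by (intro finsum_Sigma) (auto simp: v_def)
  finally have Rr: "?rhs = finsum R v B" .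
  have hB: "h ` B = A"
  proof (intro equalityI subsetI)
    fix x assume "x \<in> A"
    then obtain K j l where x: "x = (K, j, l)" and "K \<le> N" "j \<le> K" "l \<le> N - K"
      by (auto simp: A_def)
    then have "x = h (j + l, K - j, j)" "(j + l, K - j, j) \<in> B" by (auto simp: h_def B_def)
    then show "x \<in> h ` B" by blast
  qed (auto simp: A_def B_def h_def)
  have "inj_on h B" by (auto simp: inj_on_def h_def B_def)
  then have "finsum R u A = (\<Oplus>x\<in>B. u (h x))"
    using F G unfolding hB[symmetric] by (intro finsum_reindex) (auto simp: u_def)
  also have "\<dots> = finsum R v B"
  proof (intro finsum_cong')
    fix x assume "x \<in> B"
    then obtain s k j where x: "x = (s, k, j)" and "s \<le> N" "k \<le> N - s" "j \<le> s"
      by (auto simp: B_def)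
    \<comment> \<open>\<open>q\<close> and \<open>l\<close> are the x- and y-degrees from
      \<open>G\<close>; eliminating \<open>s\<close> and \<open>N\<close> removes the truncated
      subtractions.\<close>
    moreover define l q where "l = s - j" and "q = N - s - k"
    ultimately have s: "s = j + l" and N: "N = k + j + l + q" by auto
    have "u (h x) = [(t ^ (j + l) * ((k + j + l + q choose (k + j)) * (k + j choose j) * (l + q choose l)))]
        \<cdot> (F k j \<otimes> G q l)"
      unfolding x s N u_def h_def by (simp add: mult_ac add_ac)
    also have "\<dots> = v x"
      unfolding choose_mult_rearrange unfolding x s N v_def by (simp add: mult_ac add_ac)
    finally show "u (h x) = v x" .
  qed (use F G in \<open>auto simp: v_def\<close>)
  finally show ?thesis using L Rr by simp
qed

lemma armendariz_double_series:
  assumes A: "armendariz_hurwitz_series R"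
    and F: "\<And>n m. F n m \<in> carrier R" and G: "\<And>n m. G n m \<in> carrier R"
    and FG: "\<And>n s. (\<Oplus>k\<in>{..n}. [(n choose k)] \<cdot>
            (\<Oplus>j\<in>{..s}. [(s choose j)] \<cdot> (F k j \<otimes> G (n - k) (s - j)))) = \<zero>"
  shows "F n m \<otimes> G n' m' = \<zero>"
proof -
  \<comment> \<open>\<open>P H K t\<close> is the coefficient of \<open>x^K / K!\<close> in
    \<open>H\<close> after substituting y = t x.\<close>
  define P where "P H K t = (\<Oplus>j\<in>{..K}. [(t ^ j)] \<cdot> ([(K choose j)] \<cdot> H (K - j) j))"
    for H :: "nat \<Rightarrow> nat \<Rightarrow> 'a" and K t :: nat
  have PC: "P H K t \<in> carrier R" if "\<And>n m. H n m \<in> carrier R" for H K t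
    using that by (auto simp: P_def)
  have "P F K t \<otimes> P G M t = \<zero>" for K M t
  proof (rule armendariz_hurwitz_seriesD[OF A, where f = "\<lambda>K. P F K t" and g = "\<lambda>K. P G K t"])
    fix N
    show "(\<Oplus>K\<in>{..N}. [(N choose K)] \<cdot> (P F K t \<otimes> P G (N - K) t)) = \<zero>"
      unfolding P_def hurwitz_substitution[of F G, OF F G] FG by simp
  qed (use F G PC in auto)
  \<comment> \<open>With the total degrees fixed at \<open>n + m\<close> and \<open>n' + m'\<close>,
    both factors are polynomials in \<open>t\<close>. Beyond these bounds the binomials vanish, so
    truncated indices in \<open>p\<close> and \<open>q\<close> do no harm.\<close>
  then have "([(n + m choose m)] \<cdot> F (n + m - m) m) \<otimes> ([(n' + m' choose m')] \<cdot> G (n' + m' - m') m') = \<zero>"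
    using F G unfolding P_def
    by (intro armendariz_evaluation[OF A, where m = "n + m" and n = "n' + m'"
        and p = "\<lambda>j. [(n + m choose j)] \<cdot> F (n + m - j) j"
        and q = "\<lambda>j. [(n' + m' choose j)] \<cdot> G (n' + m' - j) j"])
      (auto simp: binomial_eq_0)
  \<comment> \<open>The remaining binomials are positive and are cancelled by
    torsion-freeness.\<close>
  then have "[((n' + m' choose m') * (n + m choose m))] \<cdot> (F n m \<otimes> G n' m') = \<zero>"
    using F G by (simp add: add_pow_ldistr add_pow_rdistr add.nat_pow_pow mult_ac)
  then show ?thesis
    by (rule torsion_freeD[OF armendariz_imp_torsion_free[OF A]]) (use F G in auto)
qed

section \<open>Arithmetic of the Hurwitz polynomial ring\<close>

lemma hurwitz_poly_carrier:
  "f \<in> carrier (hurwitz_poly_ring R) \<longleftrightarrow> (\<forall>n. f n \<in> carrier R) \<and> finite {n. f n \<noteq> \<zero>}"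
  by (simp add: hurwitz_poly_ring_def hurwitz_series_ring_def)

lemma hurwitz_poly_simps:
  "\<zero>\<^bsub>hurwitz_poly_ring R\<^esub> = (\<lambda>n. \<zero>)"
  "f \<oplus>\<^bsub>hurwitz_poly_ring R\<^esub> g = (\<lambda>n. f n \<oplus> g n)"
  "f \<otimes>\<^bsub>hurwitz_poly_ring R\<^esub> g = (\<lambda>n. \<Oplus>k\<in>{..n}. [(n choose k)] \<cdot> (f k \<otimes> g (n - k)))"
  by (simp_all add: hurwitz_poly_ring_def hurwitz_series_ring_def)

lemma abelian_monoid_hurwitz_poly: "abelian_monoid (hurwitz_poly_ring R)"
proof (rule abelian_monoidI)
  fix f g assume fg: "f \<in> carrier (hurwitz_poly_ring R)" "g \<in> carrier (hurwitz_poly_ring R)"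
  have "{n. f n \<oplus> g n \<noteq> \<zero>} \<subseteq> {n. f n \<noteq> \<zero>} \<union> {n. g n \<noteq> \<zero>}" by auto
  with fg show "f \<oplus>\<^bsub>hurwitz_poly_ring R\<^esub> g \<in> carrier (hurwitz_poly_ring R)"
    by (auto simp: hurwitz_poly_carrier hurwitz_poly_simps intro: finite_subset)
qed (auto simp: hurwitz_poly_carrier hurwitz_poly_simps a_ac)

text \<open>Degree bounds add: beyond \<open>a + b\<close> every term of the convolution has a zero
  factor.\<close>

lemma hurwitz_poly_mult_closed:
  assumes f: "f \<in> carrier (hurwitz_poly_ring R)" and g: "g \<in> carrier (hurwitz_poly_ring R)"
  shows "f \<otimes>\<^bsub>hurwitz_poly_ring R\<^esub> g \<in> carrier (hurwitz_poly_ring R)"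
proof -
  obtain a where a: "\<And>n. a < n \<Longrightarrow> f n = \<zero>"
    using f unfolding hurwitz_poly_carrier finite_nat_set_iff_bounded_le
    by (metis (mono_tags) mem_Collect_eq not_less)
  obtain b where b: "\<And>n. b < n \<Longrightarrow> g n = \<zero>"
    using g unfolding hurwitz_poly_carrier finite_nat_set_iff_bounded_le
    by (metis (mono_tags) mem_Collect_eq not_less)
  have "(f \<otimes>\<^bsub>hurwitz_poly_ring R\<^esub> g) n = \<zero>" if n: "a + b < n" for n
    unfolding hurwitz_poly_simps
  proof (rule add.finprod_one_eqI)
    fix k
    have "f k = \<zero> \<or> g (n - k) = \<zero>" using n a[of k] b[of "n - k"] by linarith
    then show "[(n choose k)] \<cdot> (f k \<otimes> g (n - k)) = \<zero>"
      using f g by (auto simp: hurwitz_poly_carrier)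
  qed
  then have "{n. (f \<otimes>\<^bsub>hurwitz_poly_ring R\<^esub> g) n \<noteq> \<zero>} \<subseteq> {..a + b}"
    by (auto simp: not_less[symmetric])
  then have "finite {n. (f \<otimes>\<^bsub>hurwitz_poly_ring R\<^esub> g) n \<noteq> \<zero>}"
    by (rule finite_subset) simp
  then show ?thesis
    using f g unfolding hurwitz_poly_carrier by (auto simp: hurwitz_poly_simps hurwitz_poly_carrier)
qed

lemma hurwitz_poly_finsum:
  assumes "\<And>x. x \<in> A \<Longrightarrow> f x \<in> carrier (hurwitz_poly_ring R)"
  shows "(\<Oplus>\<^bsub>hurwitz_poly_ring R\<^esub>x\<in>A. f x) n = (\<Oplus>x\<in>A. f x n)"
proof -
  interpret P: abelian_monoid "hurwitz_poly_ring R" by (rule abelian_monoid_hurwitz_poly)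
  show ?thesis
    using assms
    \<comment> \<open>For infinite \<open>A\<close> both sums are zero by convention.\<close>
    by (induction A rule: infinite_finite_induct)
      (auto simp: hurwitz_poly_simps hurwitz_poly_carrier Pi_def)
qed

lemma hurwitz_poly_add_pow:
  fixes m :: nat
  assumes "f \<in> carrier (hurwitz_poly_ring R)"
  shows "([m] \<cdot>\<^bsub>hurwitz_poly_ring R\<^esub> f) n = [m] \<cdot> f n"
proof -
  interpret P: abelian_monoid "hurwitz_poly_ring R" by (rule abelian_monoid_hurwitz_poly)
  show ?thesis by (induction m) (simp_all add: hurwitz_poly_simps)
qed

text \<open>Identifies the product in \<open>H(hR)\<close> with the double convolution treated in
  \<open>armendariz_double_series\<close>.\<close>

lemma hurwitz_poly_series_mult:
  assumes F: "\<And>i. F i \<in> carrier (hurwitz_poly_ring R)"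
    and G: "\<And>i. G i \<in> carrier (hurwitz_poly_ring R)"
  shows "(\<Oplus>\<^bsub>hurwitz_poly_ring R\<^esub>k\<in>{..n}. [(n choose k)] \<cdot>\<^bsub>hurwitz_poly_ring R\<^esub>
            (F k \<otimes>\<^bsub>hurwitz_poly_ring R\<^esub> G (n - k))) s
       = (\<Oplus>k\<in>{..n}. [(n choose k)] \<cdot>
            (\<Oplus>j\<in>{..s}. [(s choose j)] \<cdot> (F k j \<otimes> G (n - k) (s - j))))"
proof -
  interpret P: abelian_monoid "hurwitz_poly_ring R" by (rule abelian_monoid_hurwitz_poly)
  show ?thesis
    using F G
    by (simp add: hurwitz_poly_finsum hurwitz_poly_add_pow hurwitz_poly_mult_closed)
      (simp add: hurwitz_poly_simps)
qed

section \<open>The two implications\<close>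

lemma armendariz_imp_hurwitz_poly:
  assumes A: "armendariz_hurwitz_series R"
  shows "armendariz_hurwitz_series (hurwitz_poly_ring R)"
proof (rule armendariz_hurwitz_seriesI[OF abelian_monoid_hurwitz_poly])
  fix F G :: "nat \<Rightarrow> nat \<Rightarrow> 'a" and i j
  assume F: "\<And>i. F i \<in> carrier (hurwitz_poly_ring R)"
    and G: "\<And>i. G i \<in> carrier (hurwitz_poly_ring R)"
    and "\<And>n. (\<Oplus>\<^bsub>hurwitz_poly_ring R\<^esub>k\<in>{..n}. [(n choose k)] \<cdot>\<^bsub>hurwitz_poly_ring R\<^esub>
            (F k \<otimes>\<^bsub>hurwitz_poly_ring R\<^esub> G (n - k))) = \<zero>\<^bsub>hurwitz_poly_ring R\<^esub>"
  then have "(\<Oplus>k\<in>{..n}. [(n choose k)] \<cdot>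
            (\<Oplus>j\<in>{..s}. [(s choose j)] \<cdot> (F k j \<otimes> G (n - k) (s - j)))) = \<zero>" for n s
    unfolding hurwitz_poly_series_mult[of F G, OF F G, symmetric] by (simp add: hurwitz_poly_simps(1))
  then have "F i m \<otimes> G j m' = \<zero>" for m m'
    using F G by (intro armendariz_double_series[OF A]) (auto simp: hurwitz_poly_carrier)
  \<comment> \<open>Each entry of this product is a sum of multiples of the vanishing products
    \<open>F i m \<otimes> G j m'\<close>.\<close>
  then show "F i \<otimes>\<^bsub>hurwitz_poly_ring R\<^esub> G j = \<zero>\<^bsub>hurwitz_poly_ring R\<^esub>"
    by (simp add: hurwitz_poly_simps)
qed

lemma hurwitz_poly_imp_armendariz:
  assumes A: "armendariz_hurwitz_series (hurwitz_poly_ring R)"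
  shows "armendariz_hurwitz_series R"
proof (rule armendariz_hurwitz_seriesI[OF abelian_monoid_axioms])
  fix f g :: "nat \<Rightarrow> 'a" and i j
  assume f: "\<And>i. f i \<in> carrier R" and g: "\<And>i. g i \<in> carrier R"
    and fg: "\<And>n. (\<Oplus>k\<in>{..n}. [(n choose k)] \<cdot> (f k \<otimes> g (n - k))) = \<zero>"
  \<comment> \<open>\<open>C a\<close> is the series over \<open>hR\<close> whose terms are the
    constant Hurwitz polynomials \<open>a i\<close>.\<close>
  define C where "C a i m = (if m = 0 then a i else \<zero>)" for a :: "nat \<Rightarrow> 'a" and i m :: nat
  have C: "C a i \<in> carrier (hurwitz_poly_ring R)" if "\<And>i. a i \<in> carrier R" for a :: "nat \<Rightarrow> 'a" and i
    using that by (auto simp: hurwitz_poly_carrier C_def intro: finite_subset[of _ "{0}"])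
  \<comment> \<open>Constants multiply to constants, so only entry \<open>s = 0\<close> survives,
    where the hypothesis \<open>fg\<close> applies.\<close>
  have prod: "(\<Oplus>j\<in>{..s}. [(s choose j)] \<cdot> (C f a j \<otimes> C g b (s - j)))
      = (if s = 0 then f a \<otimes> g b else \<zero>)" for a b s
  proof (cases "s = 0")
    case False
    then have "[(s choose j)] \<cdot> (C f a j \<otimes> C g b (s - j)) = \<zero>" for j
      using f g by (cases "j = 0") (auto simp: C_def)
    with False show ?thesis by simp
  qed (use f g in \<open>simp add: C_def\<close>)
  have "(\<Oplus>\<^bsub>hurwitz_poly_ring R\<^esub>k\<in>{..n}. [(n choose k)] \<cdot>\<^bsub>hurwitz_poly_ring R\<^esub>
            (C f k \<otimes>\<^bsub>hurwitz_poly_ring R\<^esub> C g (n - k))) = \<zero>\<^bsub>hurwitz_poly_ring R\<^esub>" for n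
  proof
    fix s
    show "(\<Oplus>\<^bsub>hurwitz_poly_ring R\<^esub>k\<in>{..n}. [(n choose k)] \<cdot>\<^bsub>hurwitz_poly_ring R\<^esub>
            (C f k \<otimes>\<^bsub>hurwitz_poly_ring R\<^esub> C g (n - k))) s = \<zero>\<^bsub>hurwitz_poly_ring R\<^esub> s"
      unfolding hurwitz_poly_series_mult[of "C f" "C g", OF C[OF f] C[OF g]] prod hurwitz_poly_simps(1)
      using fg by (cases "s = 0") simp_all
  qed
  then have "C f i \<otimes>\<^bsub>hurwitz_poly_ring R\<^esub> C g j = \<zero>\<^bsub>hurwitz_poly_ring R\<^esub>"
    by (intro armendariz_hurwitz_seriesD[OF A] C f g)
  then have "(C f i \<otimes>\<^bsub>hurwitz_poly_ring R\<^esub> C g j) 0 = \<zero>"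
    by (simp add: hurwitz_poly_simps)
  then show "f i \<otimes> g j = \<zero>"
    using prod[of 0 i j] by (simp add: hurwitz_poly_simps)
qed

end

theorem proposition3p1:
  fixes R :: "('a, 'm) ring_scheme"
  assumes "ring R"
  shows "armendariz_hurwitz_series R \<longleftrightarrow> armendariz_hurwitz_series (hurwitz_poly_ring R)"
  using ring.armendariz_imp_hurwitz_poly[OF assms] ring.hurwitz_poly_imp_armendariz[OF assms]
  by blast

end
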